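(* Let $F$ be a field. Suppose $\alpha\in F\setminus\{0,1\}$ is an element such that $\lambda=1/(\alpha-1)$ is an algebraic integer in $F$. Then: (a) If $\deg\lambda=1$, then $E(n,\lambda)=n-\Theta(\sqrt{n})$ as $n\to\infty$ and $N(r,\{1,\alpha\})=\Theta(r^2)$ as $r\to\infty$. (b) If $\lambda$ has degree $d>1$, then $$\tfrac{d}{d-1}r-O(\sqrt{r})\leq N(r,\{1,\alpha\})\leq \tfrac{d}{d-1}(r+1),\qquad \tfrac{n}{d}-O(\sqrt{n})\leq E(n,\lambda)\leq \tfrac{n}{d}.$$
   Context: For a subset $L$ of a field $F$, an $L$-matrix is a square matrix over $F$ whose diagonal entries are all $0$ and each of whose off-diagonal entries belongs to $L$; in particular a $\{0,1\}$-matrix has zero diagonal and off-diagonal entries in $\{0,1\}$ (it is the adjacency matrix of a directed graph). $N(r,L)$ is the maximum $n$ such that there exists an $n\times n$ $L$-matrix of rank at most $r$. Multiplicity of an eigenvalue always means geometric multiplicity: the multiplicity of $\lambda$ in $M$ is $\dim\ker(M-\lambda I)$ (which is $0$ if $\lambda$ is not an eigenvalue). $E(n,\lambda)$ is the maximum, over all $n\times n$ $\{0,1\}$-matrices over $F$, of the multiplicity of $\lambda$. An element $\lambda\in F$ is an algebraic integer in $F$ if it is a root of some monic polynomial $x^d+a_{d-1}x^{d-1}+\dotsb+a_0$ with integer coefficients (mapped into $F$ via $\mathbb{Z}\to F$); its degree $\deg\lambda$ is the least degree of such a polynomial. The implied constants in $O(\cdot)$ and $\Theta(\cdot)$ may depend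 on $F$ and $\alpha$ (equivalently $\lambda$). *)

theory Defs
  imports
    "HOL-Library.Landau_Symbols"
    "HOL-Computational_Algebra.Polynomial"
    "Jordan_Normal_Form.Char_Poly"
    "Jordan_Normal_Form.Matrix_Kernel"
    "Jordan_Normal_Form.DL_Rank"
begin

definition is_L_matrix :: "nat \<Rightarrow> 'a::field set \<Rightarrow> 'a mat \<Rightarrow> bool" where
  "is_L_matrix n L A \<longleftrightarrow> A \<in> carrier_mat n n \<and>
     (\<forall>i<n. A $$ (i, i) = 0) \<and>
     (\<forall>i<n. \<forall>j<n. i \<noteq> j \<longrightarrow> A $$ (i, j) \<in> L)"

(* Max is unspecified on infinite sets, so any bound on max_size presupposes that the
   maximum exists; it does when 0 is not in L and L is finite. The set is never empty,
   since the empty matrix has rank 0. *)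
definition max_size :: "nat \<Rightarrow> 'a::field set \<Rightarrow> nat" where
  "max_size r L = Max {n. \<exists>A. is_L_matrix n L A \<and> vec_space.rank n A \<le> r}"

(* char_matrix A x is A - x * I. *)
definition geom_mult :: "'a::field mat \<Rightarrow> 'a \<Rightarrow> nat" where
  "geom_mult A x = kernel_dim (char_matrix A x)"

definition max_mult :: "nat \<Rightarrow> 'a::field \<Rightarrow> nat" where
  "max_mult n x = Max {geom_mult A x | A. is_L_matrix n {0, 1} A}"

(* The polynomials admitted here are those in the definition of algebraic_int: monic over
   the field, with coefficients in the image of the integers. They are the images of
   the monic integer polynomials of the same degree, in any characteristic. *)
definition algebraic_int_degree :: "'a::field \<Rightarrow> nat" where
  "algebraic_int_degree x =
     (LEAST d. \<exists>p. lead_coeff p = 1 \<and> (\<forall>i. coeff p i \<in> \<int>) \<and> poly p x = 0 \<and> degree p = d)"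

end

(* The rank of a {1,\<alpha>}-matrix M and the multiplicity of \<lambda> = 1/(\<alpha>-1) determine each other up to 1:
   if A is the {0,1}-matrix marking the entries \<alpha> of M, then M = J + (\<alpha>-1)(A - \<lambda>I), where J is
   the all-ones matrix. So everything reduces to three bounds.

   Quadratic bound: the entrywise polynomial (t-1)(t-\<alpha>) sends M to \<alpha>I, and raises rank r to
   at most r^2+r+1.

   E(n,\<lambda>) \<le> n/d: the power (t-\<lambda>)^m, m the geometric multiplicity, divides the characteristic
   polynomial of A, whose coefficients are integral. A monic integral polynomial q of least degree d
   vanishing at \<lambda> divides, over the image of the integers, every integral polynomial vanishing
   at \<lambda> (Gauss' lemma in characteristic 0), and \<lambda> is a simple root of q. So q^m divides the
   characteristic polynomial and dm \<le> n.

   E(n,\<lambda>) \<ge> n/d - O(\<surd>n): inflate the companion matrix of q, replacing each entry c by cI plus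
   a matrix of rank O(\<surd>n) that makes the block a {0,1}-matrix with zero diagonal. Such a matrix is
   obtained by identifying the indices with points of a grid and counting the lines through two
   points in |c| (or c+1) fixed directions: distinct points share at most one line. *)
theory Submission
  imports Defs
begin

section \<open>Rank and geometric multiplicity\<close>

lemma rank_plus_kernel_dim:
  fixes A :: "'a::field mat"
  assumes A: "A \<in> carrier_mat n nc"
  shows "vec_space.rank n A + kernel_dim A = nc"
proof -
  interpret K: kernel n nc A by unfold_locales (rule A)
  interpret NR: vec_space "TYPE('a)" n .
  let ?T = "\<lambda>v. A *\<^sub>v v"
  interpret L: linear_map class_ring "module_vec TYPE('a) nc" "module_vec TYPE('a) n" ?T
    using A by unfold_locales
      (auto simp: module_hom_def module_vec_simps class_ring_simps mult_add_distrib_mat_vec mult_mat_vec)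
  have "L.imT = NR.col_space A"
    unfolding NR.col_space_eq[OF A] L.im_def using A by (auto simp: module_vec_simps)
  moreover have "L.kerT = mat_kernel A"
    unfolding L.ker_def mat_kernel[OF A] by (auto simp: module_vec_simps)
  ultimately show ?thesis
    using L.rank_nullity[OF K.NC.fin_dim] K.NC.dim_is_n
    by (simp add: NR.rank_def NR.col_space_def)
qed

text \<open>Both directions of the base change are kept: \<open>A = Q * B\<close> yields a rank
  factorization of \<open>A\<close>, while \<open>B = P * A\<close> exhibits combinations of rows of
  \<open>A\<close> that vanish.\<close>

lemma row_reduction:
  fixes A :: "'a::field mat"
  assumes A: "A \<in> carrier_mat n nc"
  obtains P Q B where "P \<in> carrier_mat n n" "Q \<in> carrier_mat n n" "B \<in> carrier_mat n nc"
    "P * Q = 1\<^sub>m n" "B = P * A" "A = Q * B"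
    "card {i. i < n \<and> row B i \<noteq> 0\<^sub>v nc} = vec_space.rank n A"
proof -
  define B where "B = gauss_jordan_single A"
  from gauss_jordan_single[OF A B_def[symmetric]] obtain P Q where
    B: "B \<in> carrier_mat n nc" "row_echelon_form B" and BPA: "B = P * A"
    and PQ: "P \<in> carrier_mat n n" "Q \<in> carrier_mat n n" "P * Q = 1\<^sub>m n" "Q * P = 1\<^sub>m n"
    by blast
  have "A = Q * B"
    using A PQ by (simp add: BPA assoc_mult_mat[symmetric])
  moreover have "mat_kernel B = mat_kernel A"
    unfolding BPA by (rule mat_kernel_mult_eq[OF A PQ(1,2,4)])
  then have "kernel_dim A = kernel_dim B"
    using A B(1) by (simp add: kernel_dim_def)
  then have "kernel_dim A = nc - card {i. i < n \<and> row B i \<noteq> 0\<^sub>v nc}"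
    using find_base_vectors(6)[OF B(2,1)] B(1) by (simp add: kernel_dim_def)
  \<comment> \<open>The formula for \<open>kernel_dim A\<close> is a truncated difference; this
    bound makes it a genuine one. Nonzero rows have their pivots in distinct columns.\<close>
  moreover have "card {i. i < n \<and> row B i \<noteq> 0\<^sub>v nc} \<le> nc"
  proof -
    from B obtain f where f: "pivot_fun B f nc" by (auto simp: row_echelon_form_def)
    note piv = pivot_positions[OF B(1) f]
    have "length (pivot_positions B) = card (snd ` set (pivot_positions B))"
      using distinct_card[OF piv(3)] by simp
    also have "snd ` set (pivot_positions B) \<subseteq> {..<nc}"
      using pivot_funD(1)[OF _ f] B(1) unfolding piv(1) by (fastforce simp: le_less)
    then have "card (snd ` set (pivot_positions B)) \<le> nc"
      using card_mono[of "{..<nc}"] by fastforce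
    finally show ?thesis using piv(4) by simp
  qed
  ultimately show thesis
    using that[OF PQ(1,2) B(1) PQ(3) BPA] rank_plus_kernel_dim[OF A] by simp
qed

section \<open>Rank as a number of rank-one summands\<close>

lemma rank_le_sum_products:
  fixes A :: "'a::field mat"
  assumes "A \<in> carrier_mat n nc"
    and "\<And>i j. i < n \<Longrightarrow> j < nc \<Longrightarrow> A $$ (i, j) = (\<Sum>k<r. u i k * v k j)"
  shows "vec_space.rank n A \<le> r"
  using assms
proof (induction r arbitrary: A)
  case 0
  then have "A = 0\<^sub>m n nc" by (intro eq_matI) auto
  then show ?case by (simp add: vec_space.rank_0I)
next
  case (Suc r)
  define B where "B = mat n nc (\<lambda>(i, j). \<Sum>k<r. u i k * v k j)"
  define C where "C = mat n nc (\<lambda>(i, j). u i r * v r j)"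
  have "A = B + C"
    using Suc.prems by (intro eq_matI) (auto simp: B_def C_def)
  moreover have "vec_space.rank n B \<le> r"
    by (rule Suc.IH) (auto simp: B_def)
  moreover have "vec_space.rank n C \<le> 1"
    by (rule vec_space.rank_le_1_product_entries[where nc = nc and f = "\<lambda>i. u i r" and g = "v r"]) (auto simp: C_def)
  moreover have "vec_space.rank n (B + C) \<le> vec_space.rank n B + vec_space.rank n C"
    by (rule vec_space.rank_subadditive[where nc = nc]) (auto simp: B_def C_def)
  ultimately show ?case by simp
qed

lemma rank_le_sum_products_card:
  fixes A :: "'a::field mat"
  assumes A: "A \<in> carrier_mat n nc" and "finite K"
    and entries: "\<And>i j. i < n \<Longrightarrow> j < nc \<Longrightarrow> A $$ (i, j) = (\<Sum>k\<in>K. u i k * v k j)"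
  shows "vec_space.rank n A \<le> card K"
proof -
  obtain h where h: "bij_betw h {..<card K} K"
    using ex_bij_betw_nat_finite[OF \<open>finite K\<close>] by (auto simp: atLeast0LessThan)
  show ?thesis
    by (rule rank_le_sum_products[OF A, where u = "\<lambda>i k. u i (h k)" and v = "\<lambda>k. v (h k)"])
      (simp add: entries sum.reindex_bij_betw[OF h, symmetric])
qed

text \<open>Converse of the two preceding bounds: in \<open>A = Q * B\<close> only the nonzero rows
  of the echelon form \<open>B\<close> contribute, and their number is the rank.\<close>

lemma rank_factorization:
  fixes A :: "'a::field mat"
  assumes A: "A \<in> carrier_mat n nc"
  obtains K :: "nat set" and u v where "finite K" "card K = vec_space.rank n A"
    "\<forall>i<n. \<forall>j<nc. A $$ (i, j) = (\<Sum>k\<in>K. u i k * v k j)"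
proof -
  obtain P Q B where PQB: "Q \<in> carrier_mat n n" "B \<in> carrier_mat n nc" "A = Q * B"
    and card: "card {i. i < n \<and> row B i \<noteq> 0\<^sub>v nc} = vec_space.rank n A"
    by (rule row_reduction[OF A])
  let ?K = "{i. i < n \<and> row B i \<noteq> 0\<^sub>v nc}"
  have "A $$ (i, j) = (\<Sum>k\<in>?K. Q $$ (i, k) * B $$ (k, j))" if "i < n" "j < nc" for i j
  proof -
    have "B $$ (k, j) = 0" if "k < n" "k \<notin> ?K" for k
    proof -
      from that have "row B k = 0\<^sub>v nc" by simp
      then have "row B k $ j = 0" using \<open>j < nc\<close> by simp
      then show ?thesis using \<open>j < nc\<close> \<open>k < n\<close> PQB by simp
    qed
    then have "(\<Sum>k\<in>?K. Q $$ (i, k) * B $$ (k, j)) = (\<Sum>k\<in>{0..<n}. Q $$ (i, k) * B $$ (k, j))"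
      by (intro sum.mono_neutral_left) auto
    then show ?thesis
      using PQB that by (simp add: scalar_prod_def)
  qed
  then show thesis
    using card by (intro that[of ?K "\<lambda>i k. Q $$ (i, k)" "\<lambda>k j. B $$ (k, j)"]) auto
qed

lemma rank_scalar_identity:
  fixes c :: "'a::field"
  assumes "c \<noteq> 0"
  shows "vec_space.rank n (c \<cdot>\<^sub>m 1\<^sub>m n) = n"
proof -
  have "det (c \<cdot>\<^sub>m 1\<^sub>m n) \<noteq> 0"
    using assms by (simp add: det_smult)
  then show ?thesis
    by (intro vec_space.low_rank_det_zero) auto
qed

section \<open>Geometric multiplicity and the characteristic polynomial\<close>

text \<open>Every term of the Leibniz expansion takes one entry from each row in \<open>Z\<close>,
  hence contains \<open>card Z\<close> factors divisible by \<open>c\<close>.\<close>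

lemma power_dvd_det:
  fixes M :: "'a::comm_ring_1 mat"
  assumes M: "M \<in> carrier_mat n n" and Z: "Z \<subseteq> {0..<n}"
    and dvd: "\<And>i j. i \<in> Z \<Longrightarrow> j < n \<Longrightarrow> c dvd M $$ (i, j)"
  shows "c ^ card Z dvd det M"
  unfolding det_def'[OF M]
proof (intro dvd_sum dvd_mult)
  fix p assume "p \<in> {p. p permutes {0..<n}}"
  then have p: "p permutes {0..<n}" by simp
  have "c ^ card Z = (\<Prod>i\<in>Z. c)" by simp
  also have "\<dots> dvd (\<Prod>i\<in>Z. M $$ (i, p i))"
    using Z p by (intro prod_dvd_prod dvd) (auto simp: permutes_in_image[OF p] dest: permutes_in_image[OF p, THEN iffD2])
  also have "\<dots> dvd (\<Prod>i = 0..<n. M $$ (i, p i))"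
    using Z by (intro prod_dvd_prod_subset) auto
  finally show "c ^ card Z dvd (\<Prod>i = 0..<n. M $$ (i, p i))" .
qed

lemma geom_mult_le_n:
  assumes "A \<in> carrier_mat n n"
  shows "geom_mult A x \<le> n"
  using rank_plus_kernel_dim[of "char_matrix A x" n n] assms by (simp add: geom_mult_def)

text \<open>An invertible P puts A - x I in row echelon form; each zero row there is a row of P (t I - A)
  that vanishes at t = x, hence contributes a factor t - x to the determinant.\<close>
lemma power_geom_mult_dvd_char_poly:
  fixes A :: "'a::field mat"
  assumes A: "A \<in> carrier_mat n n"
  shows "[:- x, 1:] ^ geom_mult A x dvd char_poly A"
proof -
  interpret const: comm_ring_hom "\<lambda>a :: 'a. [:a:]" by unfold_locales auto
  let ?lift = "map_mat (\<lambda>a. [:a:])"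
  have C: "char_matrix A x \<in> carrier_mat n n" using A by simp
  obtain P Q B where PQB: "P \<in> carrier_mat n n" "Q \<in> carrier_mat n n" "B \<in> carrier_mat n n"
    "P * Q = 1\<^sub>m n" "B = P * char_matrix A x"
    and card: "card {i. i < n \<and> row B i \<noteq> 0\<^sub>v n} = vec_space.rank n (char_matrix A x)"
    by (rule row_reduction[OF C]) 
  let ?Z = "{i. i < n \<and> row B i = 0\<^sub>v n}"
  have "card ?Z + card {i. i < n \<and> row B i \<noteq> 0\<^sub>v n} = card ({..<n})"
    by (subst card_Un_disjoint[symmetric]) (auto simp: Un_def intro!: arg_cong[where f = card, of _ "{..<n}", simplified])
  then have card_Z: "card ?Z = geom_mult A x"
    using card rank_plus_kernel_dim[OF C] by (simp add: geom_mult_def)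
  define M where "M = ?lift P * char_poly_matrix A"
  have M: "M \<in> carrier_mat n n" using PQB A by (simp add: M_def)
  have "[:- x, 1:] dvd M $$ (i, j)" if "i \<in> ?Z" "j < n" for i j
  proof -
    have i: "i < n" using that by simp
    have "row B i $ j = 0" using that by simp
    then have "B $$ (i, j) = 0" using i \<open>j < n\<close> PQB(3) by simp
    then have *: "(\<Sum>k = 0..<n. P $$ (i, k) * char_matrix A x $$ (k, j)) = 0"
      using PQB(1) C i \<open>j < n\<close> unfolding PQB(5) by (simp add: scalar_prod_def)
    have "M $$ (i, j) = (\<Sum>k = 0..<n. [:P $$ (i, k):] * char_poly_matrix A $$ (k, j))"
      using PQB(1) char_poly_matrix_closed[OF A] i \<open>j < n\<close> by (simp add: M_def scalar_prod_def)
    then have "poly (M $$ (i, j)) x = (\<Sum>k = 0..<n. P $$ (i, k) * poly (char_poly_matrix A $$ (k, j)) x)"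
      by (simp add: poly_sum)
    also have "\<dots> = - (\<Sum>k = 0..<n. P $$ (i, k) * char_matrix A x $$ (k, j))"
      unfolding sum_negf[symmetric] using A \<open>j < n\<close>
      by (intro sum.cong) (auto simp: char_poly_matrix_def char_matrix_def algebra_simps)
    finally show ?thesis using * by (simp add: poly_eq_0_iff_dvd)
  qed
  then have "[:- x, 1:] ^ card ?Z dvd det M"
    by (intro power_dvd_det[OF M]) auto
  then have "[:- x, 1:] ^ geom_mult A x dvd det M"
    by (simp only: card_Z)
  moreover have "det M = [:det P:] * char_poly A"
    unfolding M_def char_poly_def using PQB A
    by (subst det_mult[of _ n]) (auto simp: const.hom_det)
  \<comment> \<open>So \<open>[:det P:]\<close> is a unit and drops out of the divisibility.\<close>
  moreover have "det P \<noteq> 0"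
    using det_mult[OF PQB(1,2)] PQB(4) by auto
  ultimately show ?thesis by (simp add: dvd_smult_iff)
qed

section \<open>Integral polynomials vanishing at an algebraic integer\<close>

text \<open>In positive characteristic this map is not injective and may lower degrees; hence the
  care below to distinguish an integer polynomial from its image.\<close>

abbreviation ipoly :: "int poly \<Rightarrow> 'a::field poly" where
  "ipoly \<equiv> map_poly of_int"

lemma algebraic_int_degree_le:
  assumes "lead_coeff p = 1" "\<And>i. coeff p i \<in> \<int>" "poly p x = 0"
  shows "algebraic_int_degree x \<le> degree p"
  unfolding algebraic_int_degree_def using assms by (intro Least_le) auto

text \<open>The polynomial over the field is lifted to the integers with the same degree, so that
  division and Gauss' lemma can be carried out there.\<close>

lemma algebraic_int_degree_attained:
  fixes x :: "'a::field"
  assumes "algebraic_int x"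
  obtains q :: "int poly" where "lead_coeff q = 1" "degree q = algebraic_int_degree x"
    "poly (ipoly q) x = 0"
proof -
  let ?P = "\<lambda>d. \<exists>p. lead_coeff p = 1 \<and> (\<forall>i. coeff p i \<in> \<int>) \<and> poly p x = 0 \<and> degree p = d"
  have "\<exists>d. ?P d" using assms by (auto elim!: algebraic_int.cases)
  then have "?P (algebraic_int_degree x)"
    unfolding algebraic_int_degree_def by (rule LeastI_ex)
  then obtain p where p: "lead_coeff p = 1" "\<forall>i. coeff p i \<in> \<int>" "poly p x = 0"
    and deg: "degree p = algebraic_int_degree x" by blast
  have "\<forall>i. \<exists>k. coeff p i = of_int k" using p(2) by (blast elim: Ints_cases)
  then obtain c where c: "\<And>i. coeff p i = of_int (c i)" by metis
  \<comment> \<open>The leading coefficient is set to 1 by hand: in positive characteristic the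
    chosen preimage of 1 under \<open>of_int\<close> may be another integer.\<close>
  define q where "q = (\<Sum>i<degree p. monom (c i) i) + monom 1 (degree p)"
  have coeff: "coeff q i = (if i < degree p then c i else if i = degree p then 1 else 0)" for i
    unfolding q_def by (simp add: coeff_sum)
  have "degree q = degree p"
    by (intro antisym degree_le le_degree) (auto simp: coeff)
  moreover have "ipoly q = p"
    using p(1) by (intro poly_eqI) (auto simp: coeff_map_poly coeff coeff_eq_0 simp flip: c)
  ultimately show thesis
    using that[of q] p deg by (simp add: coeff)
qed

section \<open>The image of the integers in positive characteristic\<close>

lemma Ints_eq_of_nat:
  fixes x :: "'a::ring_1"
  assumes "x \<in> \<int>" "CHAR('a) > 0"
  obtains n :: nat where "x = of_nat n"
proof -
  from assms obtain k where k: "x = of_int k" by (auto elim: Ints_cases)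
  define n where "n = nat (k mod int CHAR('a))"
  have "x = of_int (int CHAR('a) * (k div int CHAR('a)) + k mod int CHAR('a))"
    by (simp only: k mult_div_mod_eq)
  also have "\<dots> = of_int (k mod int CHAR('a))"
    by (simp only: of_int_add of_int_mult of_int_of_nat_eq of_nat_CHAR mult_zero_left add_0_left)
  also have "\<dots> = of_nat n"
    using assms(2) by (simp add: n_def of_nat_nat)
  finally show thesis by (rule that)
qed

text \<open>Fermat's little theorem in the prime field: the Frobenius map is additive and fixes 1,
  so induction over the naturals applies.\<close>

lemma Ints_power_CHAR:
  fixes x :: "'a::idom"
  assumes "x \<in> \<int>" "CHAR('a) > 0"
  shows "x ^ CHAR('a) = x"
proof -
  obtain n where n: "x = of_nat n" by (rule Ints_eq_of_nat[OF assms])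
  have "prime CHAR('a)" using prime_CHAR_semidom[OF assms(2)] .
  then have "of_nat n ^ CHAR('a) = (of_nat n :: 'a)"
    by (induction n) (auto simp: freshmans_dream power_0_left assms(2))
  then show ?thesis by (simp add: n)
qed

text \<open>By Fermat a nonzero \<open>x\<close> has inverse \<open>x ^ (p - 2)\<close>, where p is
  the characteristic. Hence integral polynomials can be made monic by scaling.\<close>

lemma Ints_inverse_CHAR:
  fixes x :: "'a::field"
  assumes "x \<in> \<int>" "CHAR('a) > 0"
  shows "inverse x \<in> \<int>"
proof (cases "x = 0")
  case False
  have "CHAR('a) \<ge> 2"
    using prime_CHAR_semidom[OF assms(2)] by (rule prime_ge_2_nat)
  then obtain m where m: "CHAR('a) = 2 + m" using le_Suc_ex by blast
  have "x * (x * x ^ m) = x * 1"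
    using Ints_power_CHAR[OF assms] by (simp add: m)
  then have "x * x ^ m = 1" using mult_left_cancel[OF False] by blast
  then have "inverse x = x ^ m" by (rule inverse_unique)
  then show ?thesis using assms by simp
qed simp

section \<open>Minimality among all integral polynomials, monic or not\<close>

lemma of_int_eq_0_iff_CHAR_0:
  assumes "CHAR('a::ring_1) = 0"
  shows "of_int k = (0 :: 'a) \<longleftrightarrow> k = 0"
  using assms by (simp add: of_int_eq_0_iff_char_dvd)

text \<open>In positive characteristic the leading coefficient is inverted within the image of the
  integers. In characteristic 0 a primitive integer polynomial of least degree vanishing at
  \<open>x\<close> divides a monic one by Gauss' lemma, so it is itself monic up to sign.\<close>

lemma algebraic_int_degree_le_int_poly:
  fixes x :: "'a::field"
  assumes "algebraic_int x" "poly (ipoly r) x = 0" "ipoly r \<noteq> (0 :: 'a poly)"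
  shows "algebraic_int_degree x \<le> degree r"
proof (cases "CHAR('a) = 0")
  case False
  define c where "c = lead_coeff (ipoly r :: 'a poly)"
  have c: "c \<in> \<int>" by (simp add: c_def coeff_map_poly)
  have "c \<noteq> 0" using assms(3) unfolding c_def leading_coeff_0_iff .
  have inv: "inverse c \<in> \<int>" using Ints_inverse_CHAR c False by blast
  have "algebraic_int_degree x \<le> degree (Polynomial.smult (inverse c) (ipoly r))"
  proof (rule algebraic_int_degree_le)
    show "lead_coeff (Polynomial.smult (inverse c) (ipoly r)) = 1"
      by (simp only: lead_coeff_smult c_def[symmetric] left_inverse[OF \<open>c \<noteq> 0\<close>])
  qed (use assms(2) inv in \<open>simp_all add: coeff_map_poly\<close>)
  also have "\<dots> \<le> degree r" by (simp add: degree_map_poly_le)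
  finally show ?thesis .
next
  case True
  note inj = of_int_eq_0_iff_CHAR_0[OF True]
  have "r \<noteq> 0" using assms(3) by auto
  define P where "P d \<longleftrightarrow> (\<exists>h :: int poly. h \<noteq> 0 \<and> poly (ipoly h) x = 0 \<and> degree h = d)" for d
  have "P (degree r)" using assms \<open>r \<noteq> 0\<close> by (auto simp: P_def)
  define e where "e = (LEAST d. P d)"
  have "P e" "e \<le> degree r"
    using \<open>P (degree r)\<close> by (auto simp: e_def intro: LeastI Least_le)
  then obtain g where g: "g \<noteq> 0" "poly (ipoly g) x = 0" "degree g = e" by (auto simp: P_def)
  have min: "s = 0" if "degree s < e" "poly (ipoly s) x = 0" for s
    using not_less_Least[of "degree s" P] that by (auto simp: e_def P_def)
  define h where "h = primitive_part g"
  have h: "h \<noteq> 0" "degree h = e" "content h = 1" using g by (auto simp: h_def)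
  have "g = Polynomial.smult (content g) h" by (simp add: h_def)
  then have "poly (ipoly (Polynomial.smult (content g) h)) x = 0" using g by simp
  then have hx: "poly (ipoly h) x = 0"
    using g(1) by (simp add: of_int_poly_hom.base.map_poly_hom_smult of_int_hom.map_poly_hom_smult inj)
  obtain q where q: "lead_coeff q = 1" "degree q = algebraic_int_degree x" "poly (ipoly q) x = 0"
    using algebraic_int_degree_attained[OF assms(1)] by blast
  \<comment> \<open>Over the integers \<open>q\<close> can be divided by \<open>h\<close> only after
    scaling by a power \<open>l\<close> of the leading coefficient of \<open>h\<close>; minimality
    of \<open>e\<close> kills the remainder.\<close>
  obtain s t where "pseudo_divmod q h = (s, t)" by fastforce
  note div = pseudo_divmod[OF h(1) this]
  define l where "l = lead_coeff h ^ (Suc (degree q) - degree h)"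
  have eq: "Polynomial.smult l q = h * s + t" using div(1) by (simp add: l_def)
  have "poly (ipoly (Polynomial.smult l q)) x = poly (ipoly (h * s + t)) x" by (simp only: eq)
  then have "poly (ipoly t) x = 0" using q(3) hx by (simp add: hom_distribs)
  then have "t = 0" using min[of t] div(2) h(2) by auto
  then have "h dvd Polynomial.smult l q" using eq by simp
  \<comment> \<open>Gauss' lemma: passing to primitive parts removes the factor \<open>l\<close> up
    to sign.\<close>
  then have "primitive_part h dvd primitive_part (Polynomial.smult l q)" by blast
  moreover have "content q = 1"
  proof -
    have "content q dvd 1" using content_dvd_coeff[of q "degree q"] q(1) by simp
    then show ?thesis by (simp only: is_unit_content_iff)
  qed
  ultimately have "h dvd Polynomial.smult (unit_factor l) q"
    using h(3) by (simp add: primitive_part_smult primitive_part_prim)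
  moreover have "l \<noteq> 0" using h(1) by (simp add: l_def)
  then have "q = Polynomial.smult (unit_factor l) (Polynomial.smult (unit_factor l) q)"
    by (simp add: sgn_if)
  ultimately have "h dvd q"
    using dvd_smult[of h "Polynomial.smult (unit_factor l) q" "unit_factor l"] by simp
  then obtain k where k: "q = h * k" ..
  \<comment> \<open>Hence scaling \<open>h\<close> by the leading coefficient of \<open>k\<close>
    makes it monic without changing its degree.\<close>
  have u: "lead_coeff h * lead_coeff k = 1" using q(1) by (simp add: k lead_coeff_mult)
  define u where "u = lead_coeff k"
  have "algebraic_int_degree x \<le> degree (ipoly (Polynomial.smult u h) :: 'a poly)"
  proof (rule algebraic_int_degree_le)
    have lead: "coeff (ipoly (Polynomial.smult u h)) (degree h) = (1 :: 'a)"
      using u by (simp add: coeff_map_poly u_def mult.commute flip: of_int_mult)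
    have "degree (ipoly (Polynomial.smult u h) :: 'a poly) = degree h"
    proof (rule antisym)
      show "degree (ipoly (Polynomial.smult u h) :: 'a poly) \<le> degree h"
        by (rule order_trans[OF degree_map_poly_le degree_smult_le])
      show "degree h \<le> degree (ipoly (Polynomial.smult u h) :: 'a poly)"
        by (rule le_degree) (simp only: lead, simp)
    qed
    then show "lead_coeff (ipoly (Polynomial.smult u h) :: 'a poly) = 1" using lead by (simp only:)
  qed (use hx in \<open>auto simp: coeff_map_poly of_int_hom.map_poly_hom_smult\<close>)
  also have "\<dots> \<le> degree (Polynomial.smult u h)" by (rule degree_map_poly_le)
  also have "\<dots> \<le> degree r" using h(2) \<open>e \<le> degree r\<close> by (auto intro: order_trans[OF degree_smult_le])
  finally show ?thesis .
qed

text \<open>As \<open>q\<close> is monic, pseudo-division is ordinary division with remainder. The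
  remainder vanishes at \<open>x\<close> and has smaller degree than \<open>q\<close>, so its image
  is zero; the integer remainder itself need not be, hence a conclusion about images.\<close>

lemma minimal_int_poly_divides:
  fixes x :: "'a::field"
  assumes "algebraic_int x"
    and q: "lead_coeff q = 1" "degree q = algebraic_int_degree x" "poly (ipoly q) x = 0"
    and f: "poly (ipoly f) x = 0"
  obtains g where "(ipoly f :: 'a poly) = ipoly q * ipoly g"
proof -
  obtain s t where "pseudo_divmod f q = (s, t)" by fastforce
  note div = pseudo_divmod[OF _ this]
  have eq: "f = q * s + t" and t: "t = 0 \<or> degree t < degree q" using div q(1) by fastforce+
  have tx: "poly (ipoly t) x = 0"
    using f q(3) unfolding eq by (simp add: hom_distribs)
  have "ipoly t = (0 :: 'a poly)"
    using t algebraic_int_degree_le_int_poly[OF assms(1) tx] q(2) by fastforce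
  then show thesis
    using that[of s] by (simp add: eq hom_distribs)
qed

text \<open>If the derivative vanished at \<open>x\<close>, minimality would make its image zero.
  This is impossible in characteristic 0; in characteristic p the image of \<open>q\<close> would be
  a polynomial in t^p, hence by Fermat the p-th power of a polynomial of smaller degree vanishing at
  \<open>x\<close>.\<close>

lemma minimal_int_poly_separable:
  fixes x :: "'a::field"
  assumes "algebraic_int x"
    and q: "lead_coeff q = 1" "degree q = algebraic_int_degree x" "poly (ipoly q) x = 0"
  shows "poly (pderiv (ipoly q)) x \<noteq> 0"
proof
  assume *: "poly (pderiv (ipoly q)) x = 0"
  have d: "degree q > 0"
  proof (rule ccontr)
    assume "\<not> degree q > 0"
    then have "q = 1" using q(1) by (auto elim!: degree_eq_zeroE simp: one_pCons)
    then show False using q(3) by simp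
  qed
  have "ipoly (pderiv q) = (0 :: 'a poly)"
  proof (rule ccontr)
    assume "ipoly (pderiv q) \<noteq> (0 :: 'a poly)"
    then have "algebraic_int_degree x \<le> degree (pderiv q)"
      using * by (intro algebraic_int_degree_le_int_poly[OF assms(1)]) (simp_all add: of_int_hom.map_poly_pderiv)
    then show False using d q(2) by (simp add: degree_pderiv)
  qed
  then have coeffs: "of_nat (Suc i) * of_int (coeff q (Suc i)) = (0 :: 'a)" for i
  proof -
    have "coeff (ipoly (pderiv q)) i = (0 :: 'a)" using \<open>ipoly (pderiv q) = 0\<close> by simp
    then show ?thesis by (simp add: coeff_map_poly coeff_pderiv)
  qed
  \<comment> \<open>The leading coefficient shows that the characteristic divides the positive
    number \<open>degree q\<close>, which rules out characteristic 0.\<close>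
  from coeffs[of "degree q - 1"] have "of_nat (degree q) = (0 :: 'a)" using d q(1) by simp
  then have "CHAR('a) dvd degree q" by (simp add: of_nat_eq_0_iff_char_dvd)
  then obtain e where e: "degree q = CHAR('a) * e" ..
  with d have pos: "CHAR('a) > 0" "e > 0" by auto
  define p where "p = CHAR('a)"
  have p: "prime p" unfolding p_def by (rule prime_CHAR_semidom[OF pos(1)])
  have zero: "of_int (coeff q i) = (0 :: 'a)" if "\<not> p dvd i" for i
    using coeffs[of "i - 1"] that by (cases i) (auto simp: p_def of_nat_eq_0_iff_char_dvd simp del: of_nat_Suc)
  \<comment> \<open>Chosen so that the image of \<open>q\<close> is g(t^p).\<close>
  define g :: "'a poly" where "g = (\<Sum>j\<le>e. monom (of_int (coeff q (p * j))) j)"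
  have coeff_g: "coeff g i = (if i \<le> e then of_int (coeff q (p * i)) else 0)" for i
    by (simp add: g_def coeff_sum)
  have lead_g: "coeff g e = 1" using q(1) e by (simp add: coeff_g p_def)
  have deg_g: "degree g = e"
    using lead_g by (intro antisym le_degree degree_le) (auto simp: coeff_g)
  \<comment> \<open>The Frobenius map distributes over the sum and fixes the coefficients, which
    turns g(x)^p into q(x).\<close>
  have "poly g x ^ p = (\<Sum>j\<le>e. (of_int (coeff q (p * j)) * x ^ j) ^ p)"
    using p by (simp add: g_def poly_sum poly_monom p_def freshmans_dream_sum)
  also have "\<dots> = (\<Sum>j\<le>e. of_int (coeff q (p * j)) * x ^ (p * j))"
    using Ints_power_CHAR[OF Ints_of_int pos(1)]
    by (simp add: power_mult_distrib p_def mult.commute[of "CHAR('a)"] power_mult)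
  also have "\<dots> = (\<Sum>i\<in>(\<lambda>j. p * j) ` {..e}. of_int (coeff q i) * x ^ i)"
    using p by (subst sum.reindex) (auto simp: inj_on_def prime_gt_0_nat)
  also have "\<dots> = (\<Sum>i\<le>degree q. of_int (coeff q i) * x ^ i)"
  proof (rule sum.mono_neutral_left)
    show "\<forall>i\<in>{..degree q} - (\<lambda>j. p * j) ` {..e}. of_int (coeff q i) * x ^ i = 0"
    proof
      fix i assume i: "i \<in> {..degree q} - (\<lambda>j. p * j) ` {..e}"
      have "\<not> p dvd i"
      proof
        assume "p dvd i"
        then obtain j where "i = p * j" ..
        then show False using i e pos(1) by (auto simp: p_def)
      qed
      then show "of_int (coeff q i) * x ^ i = 0" by (simp add: zero)
    qed
  qed (auto simp: e p_def)
  also have "\<dots> = poly (ipoly q) x"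
  proof -
    have "degree (ipoly q :: 'a poly) = degree q"
      using q(1) by (intro degree_map_poly) auto
    then show ?thesis by (simp add: poly_altdef coeff_map_poly)
  qed
  finally have "poly g x = 0" using q(3) by simp
  then have "algebraic_int_degree x \<le> degree g"
    using lead_g by (intro algebraic_int_degree_le) (auto simp: deg_g coeff_g)
  then have "CHAR('a) * e \<le> e" using deg_g q(2) e by simp
  then show False using pos p prime_ge_2_nat[OF p] by (simp add: p_def)
qed

lemma minimal_int_poly_order:
  fixes x :: "'a::field"
  assumes "algebraic_int x"
    and q: "lead_coeff q = 1" "degree q = algebraic_int_degree x" "poly (ipoly q) x = 0"
  shows "Polynomial.order x (ipoly q) = 1"
proof -
  let ?q = "ipoly q :: 'a poly"
  have sep: "poly (pderiv ?q) x \<noteq> 0" by (rule minimal_int_poly_separable[OF assms])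
  then have nz: "?q \<noteq> 0" by auto
  have "\<not> Polynomial.order x ?q \<ge> 2"
  proof
    assume "Polynomial.order x ?q \<ge> 2"
    then have "[:- x, 1:] ^ 2 dvd ?q"
      using order_1 le_imp_power_dvd dvd_trans by blast
    then obtain s where s: "?q = [:- x, 1:] ^ 2 * s" ..
    define l where "l = [:- x, 1:]"
    have "poly l x = 0" by (simp add: l_def)
    then show False
      using sep unfolding s l_def[symmetric] by (simp add: pderiv_mult power2_eq_square)
  qed
  moreover have "Polynomial.order x ?q \<noteq> 0" using q(3) nz by (simp add: order_root)
  ultimately show ?thesis by linarith
qed

text \<open>Splitting off \<open>q\<close> lowers the order at \<open>x\<close> by exactly 1 and the
  degree by \<open>algebraic_int_degree x\<close>; the cofactor is again the image of an integer
  polynomial, so induction on the degree applies.\<close>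

lemma order_times_algebraic_int_degree_le:
  fixes x :: "'a::field"
  assumes x: "algebraic_int x" and "ipoly f \<noteq> (0 :: 'a poly)"
  shows "Polynomial.order x (ipoly f) * algebraic_int_degree x \<le> degree (ipoly f :: 'a poly)"
  using assms(2)
proof (induction "degree (ipoly f :: 'a poly)" arbitrary: f rule: less_induct)
  case less
  show ?case
  proof (cases "poly (ipoly f) x = 0")
    case False
    then show ?thesis by (simp add: order_root less.prems)
  next
    case True
    obtain q where q: "lead_coeff q = 1" "degree q = algebraic_int_degree x" "poly (ipoly q) x = 0"
      using algebraic_int_degree_attained[OF x] by blast
    obtain g where g: "(ipoly f :: 'a poly) = ipoly q * ipoly g"
      by (rule minimal_int_poly_divides[OF x q True])
    note ord = minimal_int_poly_order[OF x q]
    have nz: "ipoly q * ipoly g \<noteq> (0 :: 'a poly)" using less.prems g by simp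
    have degq: "degree (ipoly q :: 'a poly) = algebraic_int_degree x"
      using q by (subst degree_map_poly) auto
    have deg: "degree (ipoly f :: 'a poly) = algebraic_int_degree x + degree (ipoly g :: 'a poly)"
      using nz degq by (simp add: g degree_mult_eq)
    have "degree (ipoly q :: 'a poly) \<noteq> 0"
    proof
      assume "degree (ipoly q :: 'a poly) = 0"
      then obtain c :: 'a where "ipoly q = [:c:]" by (rule degree_eq_zeroE)
      then show False using q(3) nz by simp
    qed
    then have "degree (ipoly g :: 'a poly) < degree (ipoly f :: 'a poly)"
      using deg degq by simp
    then have "Polynomial.order x (ipoly g) * algebraic_int_degree x \<le> degree (ipoly g :: 'a poly)"
      using nz by (intro less.hyps) auto
    moreover have "Polynomial.order x (ipoly f) = 1 + Polynomial.order x (ipoly g)"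
      using nz ord by (simp add: g order_mult)
    ultimately show ?thesis using deg by simp
  qed
qed

section \<open>Matrices of large multiplicity\<close>

text \<open>Row \<open>i\<close> of the summand \<open>s\<close> depends on \<open>i\<close> only
  through \<open>\<phi> s i\<close>, so that summand has at most \<open>card X\<close> distinct
  rows.\<close>

lemma rank_le_sum_distinct_rows:
  fixes A :: "'a::field mat"
  assumes A: "A \<in> carrier_mat n nc" and "finite X"
    and "\<And>s i. s < S \<Longrightarrow> i < n \<Longrightarrow> \<phi> s i \<in> X"
    and "\<And>i j. i < n \<Longrightarrow> j < nc \<Longrightarrow> A $$ (i, j) = (\<Sum>s<S. h s (\<phi> s i) j)"
  shows "vec_space.rank n A \<le> S * card X"
proof -
  have "vec_space.rank n A \<le> card ({..<S} \<times> X)"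
  proof (rule rank_le_sum_products_card[OF A, where
        u = "\<lambda>i (s, t). if t = \<phi> s i then 1 else 0" and v = "\<lambda>(s, t). h s t"])
    fix i j assume ij: "i < n" "j < nc"
    have "(\<Sum>k\<in>{..<S} \<times> X. (case k of (s, t) \<Rightarrow> if t = \<phi> s i then 1 else 0) * (case k of (s, t) \<Rightarrow> h s t) j)
      = (\<Sum>s<S. \<Sum>t\<in>X. (if t = \<phi> s i then 1 else 0) * h s t j)"
      by (simp add: sum.cartesian_product case_prod_beta)
    also have "\<dots> = (\<Sum>s<S. h s (\<phi> s i) j)"
      using assms(2,3) ij by (simp add: if_distrib[of "\<lambda>x. x * _"] cong: if_cong)
    finally show "A $$ (i, j) = (\<Sum>k\<in>{..<S} \<times> X. (case k of (s, t) \<Rightarrow> if t = \<phi> s i then 1 else 0)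
      * (case k of (s, t) \<Rightarrow> h s t) j)"
      using assms(4) ij by simp
  qed (use \<open>finite X\<close> in auto)
  then show ?thesis by (simp add: card_cartesian_product)
qed

text \<open>The number P encodes the grid point (P mod m, P div m), and two points lie on a common
  line of direction s iff their values under line m s agree.\<close>
definition line :: "nat \<Rightarrow> nat \<Rightarrow> nat \<Rightarrow> nat" where
  "line m s P = P mod m + s * (P div m)"

text \<open>Subtracting the two equations leaves (s - t)(y - y') = 0 over the integers; line values
  are not reduced modulo \<open>m\<close>, so s - t is nonzero.\<close>

lemma lines_meet_once:
  assumes "line m s P = line m s Q" "line m t P = line m t Q" "s \<noteq> t"
  shows "P = Q"
proof -
  define x y x' y' where "x = int (P mod m)" "y = int (P div m)" "x' = int (Q mod m)" "y' = int (Q div m)"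
  have 1: "x + int s * y = x' + int s * y'" and 2: "x + int t * y = x' + int t * y'"
    using assms(1,2) unfolding line_def x_y_x'_y'_def by (metis of_nat_add of_nat_mult)+
  then have "(int s - int t) * (y - y') = 0" by (simp add: algebra_simps)
  then have "y = y'" using assms(3) by simp
  then have "P div m = Q div m" "P mod m = Q mod m"
    using 1 by (simp_all add: x_y_x'_y'_def)
  then show ?thesis by (metis div_mult_mod_eq)
qed

definition common_lines :: "nat \<Rightarrow> nat \<Rightarrow> nat \<Rightarrow> nat \<Rightarrow> int" where
  "common_lines m k P Q = (\<Sum>s<k. of_bool (line m s P = line m s Q))"

lemma common_lines_self [simp]: "common_lines m k P P = int k"
  by (simp add: common_lines_def)

lemma common_lines_distinct:
  assumes "P \<noteq> Q"
  shows "common_lines m k P Q \<in> {0, 1}"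
proof (cases "\<exists>s<k. line m s P = line m s Q")
  case True
  then obtain s where s: "s < k" "line m s P = line m s Q" by blast
  then have "of_bool (line m t P = line m t Q) = (if t = s then 1 else 0 :: int)" for t
    using lines_meet_once[OF _ s(2), of t] assms by auto
  then show ?thesis using s by (simp add: common_lines_def)
qed (simp add: common_lines_def)

text \<open>Counting common lines in k directions gives k on the diagonal and 0 or 1 elsewhere. For
  \<open>c \<le> 0\<close> the choice k = -c lets c I cancel the diagonal. For \<open>c > 0\<close>
  the difference of the all-ones matrix and the count for k = c + 1 has diagonal -c, again cancelled
  by c I.\<close>

definition block_entry :: "nat \<Rightarrow> int \<Rightarrow> nat \<Rightarrow> nat \<Rightarrow> int" where
  "block_entry m c P Q = (if c > 0 then 1 - common_lines m (nat c + 1) P Q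
     else common_lines m (nat (- c)) P Q) + c * of_bool (P = Q)"

lemma block_entry_self [simp]: "block_entry m c P P = 0"
  by (simp add: block_entry_def)

lemma block_entry_01: "block_entry m c P Q \<in> {0, 1}"
  using common_lines_distinct[of P Q] by (cases "P = Q") (auto simp: block_entry_def)

text \<open>The summand of direction s depends on the row index only through the line of direction s,
  which takes O(m) values on an m by m grid: hence the low rank of a block minus c times the identity.\<close>
definition line_term :: "nat \<Rightarrow> int \<Rightarrow> nat \<Rightarrow> nat \<Rightarrow> nat \<Rightarrow> int" where
  "line_term m c s t Q = (if c > 0 then of_bool (s = 0) - of_bool (s < nat c + 1 \<and> t = line m s Q)
     else of_bool (s < nat (- c) \<and> t = line m s Q))"

text \<open>One range \<open>K\<close> of directions serves all blocks: directions that a block does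
  not use contribute 0, and for \<open>c > 0\<close> the constant 1 is charged to direction
  0.\<close>

lemma block_entry_eq_sum:
  assumes "nat \<bar>c\<bar> < K"
  shows "block_entry m c P Q = (\<Sum>s<K. line_term m c s (line m s P) Q) + c * of_bool (P = Q)"
proof -
  have *: "common_lines m k P Q = (\<Sum>s<K. of_bool (s < k \<and> line m s P = line m s Q))" if "k \<le> K" for k
    unfolding common_lines_def using that by (intro sum.mono_neutral_cong_left) auto
  have "(\<Sum>s<K. of_bool (s = 0)) = (1 :: int)" using assms by (simp add: of_bool_def)
  then show ?thesis
    using assms by (auto simp: block_entry_def line_term_def sum_subtractf *)
qed

section \<open>The companion matrix and its inflation\<close>

definition companion :: "int poly \<Rightarrow> nat \<Rightarrow> nat \<Rightarrow> int" where
  "companion q a b = (if b = degree q - 1 then - coeff q a else of_bool (a = b + 1))"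

text \<open>All columns but the last shift the powers of \<open>x\<close>; in the last one q(x) = 0
  expresses x^d, d the degree of \<open>q\<close>, by lower powers.\<close>

lemma companion_left_eigenvector:
  fixes x :: "'a::field"
  assumes q: "lead_coeff q = 1" "poly (ipoly q) x = 0" and b: "b < degree q"
  shows "(\<Sum>a<degree q. x ^ a * of_int (companion q a b)) = x * x ^ b"
proof (cases "b = degree q - 1")
  case True
  have "degree (ipoly q :: 'a poly) = degree q"
    using q(1) by (intro degree_map_poly) auto
  then have "0 = (\<Sum>a<Suc (degree q). of_int (coeff q a) * x ^ a)"
    using q(2) by (simp add: poly_altdef coeff_map_poly lessThan_Suc_atMost)
  then have "x ^ degree q = - (\<Sum>a<degree q. of_int (coeff q a) * x ^ a)"
    using q(1) by (simp add: eq_neg_iff_add_eq_0 add.commute)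
  moreover have "x * x ^ b = x ^ degree q"
    using True b by (simp flip: power_Suc)
  ultimately show ?thesis
    using True by (simp add: companion_def sum_negf mult.commute)
next
  case False
  then have "(\<Sum>a<degree q. x ^ a * of_int (companion q a b)) = (\<Sum>a<degree q. if a = b + 1 then x ^ a else 0)"
    by (intro sum.cong) (auto simp: companion_def)
  also have "\<dots> = x * x ^ b" using False b by simp
  finally show ?thesis .
qed

definition shifted_companion :: "int poly \<Rightarrow> 'a::field \<Rightarrow> nat \<Rightarrow> nat \<Rightarrow> 'a" where
  "shifted_companion q x a b = of_int (companion q a b) - x * of_bool (a = b)"

text \<open>The left eigenvector has first entry 1, so the relation it gives between the rows of C -
  x I, C the companion matrix, can be solved for row 0. This is the drop of the rank to d -
  1.\<close>

lemma shifted_companion_row_0: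
  assumes q: "lead_coeff q = 1" "poly (ipoly q) x = 0" and b: "b < degree q"
  shows "shifted_companion q x 0 b = (\<Sum>a\<in>{1..<degree q}. - (x ^ a) * shifted_companion q x a b)"
proof -
  have "(\<Sum>a<degree q. x ^ a * (x * of_bool (a = b))) = (\<Sum>a<degree q. if a = b then x * x ^ b else 0)"
    by (intro sum.cong) auto
  also have "\<dots> = x * x ^ b" using b by simp
  finally have "(\<Sum>a<degree q. x ^ a * shifted_companion q x a b) = 0"
    using companion_left_eigenvector[OF assms] by (simp add: shifted_companion_def right_diff_distrib sum_subtractf)
  moreover have "(\<Sum>a<degree q. x ^ a * shifted_companion q x a b)
      = shifted_companion q x 0 b + (\<Sum>a\<in>{1..<degree q}. x ^ a * shifted_companion q x a b)"
    using b by (simp add: sum.atLeast_Suc_lessThan flip: atLeast0LessThan)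
  ultimately show ?thesis by (simp add: sum_negf eq_neg_iff_add_eq_0)
qed

text \<open>\<open>T\<close> is block diagonal with copies of C - x I, each of rank at most d - 1.
  There are at most \<open>n div d + 1\<close> copies, the last possibly cut off at index
  \<open>n\<close>.\<close>

lemma rank_inflated_shifted_companion_le:
  fixes x :: "'a::field"
  assumes q: "lead_coeff q = 1" "poly (ipoly q) x = 0" and d: "degree q = d" "d > 0"
    and T: "T \<in> carrier_mat n n"
    and T_eq: "\<And>i j. i < n \<Longrightarrow> j < n \<Longrightarrow>
      T $$ (i, j) = shifted_companion q x (i mod d) (j mod d) * of_bool (i div d = j div d)"
  shows "vec_space.rank n T \<le> (d - 1) * (n div d + 1)"
proof -
  let ?K = "{1..<d} \<times> {..n div d}"
  \<comment> \<open>Coordinates of row \<open>i\<close> with respect to rows 1, ..., d - 1 of its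
    copy. If the copy is cut off, \<open>v\<close> still supplies all of these rows.\<close>
  define u where "u i k = (case k of (a, P) \<Rightarrow> of_bool (i div d = P) *
    (if i mod d = 0 then - (x ^ a) else of_bool (i mod d = a)))" for i k
  define v where "v k j = (case k of (a, P) \<Rightarrow> shifted_companion q x a (j mod d) * of_bool (P = j div d))" for k j
  have "vec_space.rank n T \<le> card ?K"
  proof (rule rank_le_sum_products_card[OF T, where u = u and v = v])
    fix i j assume ij: "i < n" "j < n"
    have mod: "i mod d < d" "j mod d < d" using d by auto
    have "i div d \<le> n div d" using ij by (simp add: div_le_mono)
    have "(\<Sum>k\<in>?K. u i k * v k j) = (\<Sum>a\<in>{1..<d}. \<Sum>P\<le>n div d. u i (a, P) * v (a, P) j)"
      by (simp add: sum.cartesian_product)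
    also have "\<dots> = (\<Sum>a\<in>{1..<d}. \<Sum>P\<le>n div d. if P = i div d then u i (a, P) * v (a, P) j else 0)"
      by (intro sum.cong) (auto simp: u_def)
    also have "\<dots> = (\<Sum>a\<in>{1..<d}. u i (a, i div d) * v (a, i div d) j)"
      using \<open>i div d \<le> n div d\<close> by simp
    also have "\<dots> = (\<Sum>a\<in>{1..<d}. (if i mod d = 0 then - (x ^ a) else of_bool (i mod d = a)) *
        shifted_companion q x a (j mod d)) * of_bool (i div d = j div d)"
      by (simp add: u_def v_def sum_distrib_right mult.assoc)
    also have "(\<Sum>a\<in>{1..<d}. (if i mod d = 0 then - (x ^ a) else of_bool (i mod d = a)) *
        shifted_companion q x a (j mod d)) = shifted_companion q x (i mod d) (j mod d)"
    proof (cases "i mod d = 0")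
      case True
      then show ?thesis using shifted_companion_row_0[OF q] mod d by simp
    next
      case False
      have "(\<Sum>a\<in>{1..<d}. of_bool (i mod d = a) * shifted_companion q x a (j mod d))
        = (\<Sum>a\<in>{1..<d}. if a = i mod d then shifted_companion q x a (j mod d) else 0)"
        by (intro sum.cong) auto
      then show ?thesis using False mod by simp
    qed
    finally show "T $$ (i, j) = (\<Sum>k\<in>?K. u i k * v k j)" using T_eq[OF ij] by simp
  qed simp
  then show ?thesis by (simp add: card_cartesian_product)
qed

section \<open>The extremal multiplicity and its lower bound\<close>

lemma is_L_matrix_01_finite_mults:
  "finite {geom_mult A x | A. is_L_matrix n {0, 1} A}"
  by (rule finite_subset[of _ "{..n}"]) (auto simp: is_L_matrix_def intro!: geom_mult_le_n)

lemma geom_mult_le_max_mult: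
  "is_L_matrix n {0, 1} A \<Longrightarrow> geom_mult A x \<le> max_mult n x"
  unfolding max_mult_def by (intro Max_ge is_L_matrix_01_finite_mults) auto

lemma max_mult_attained:
  obtains A where "is_L_matrix n {0, 1} A" "geom_mult A x = max_mult n x"
proof -
  have "is_L_matrix n {0, 1} (0\<^sub>m n n)" by (simp add: is_L_matrix_def)
  then have "max_mult n x \<in> {geom_mult A x | A. is_L_matrix n {0, 1} A}"
    unfolding max_mult_def by (intro Max_in is_L_matrix_01_finite_mults) blast
  then show thesis using that by auto
qed

lemma max_mult_le_n: "max_mult n x \<le> n"
  by (rule max_mult_attained[of n x]) (metis geom_mult_le_n is_L_matrix_def)

text \<open>Index \<open>i\<close> stands for the companion row \<open>i mod d\<close> and the grid
  point \<open>i div d\<close>; \<open>n div d < m * m\<close> makes the grid of side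
  \<open>m\<close> large enough. Then A - x I is the inflated C - x I plus a matrix of rank
  O(m).\<close>

lemma max_mult_lower_bound_grid:
  fixes x :: "'a::field"
  assumes q: "lead_coeff q = 1" "poly (ipoly q) x = 0" and d: "degree q = d" "d > 0"
  obtains D where "\<And>n m. n div d < m * m \<Longrightarrow> n \<le> max_mult n x + (d - 1) * (n div d + 1) + D * m"
proof -
  \<comment> \<open>Exceeds the absolute value of every companion entry; the summand 2 covers the
    entries 0 and 1.\<close>
  define K where "K = 2 + (\<Sum>a<d. nat \<bar>coeff q a\<bar>)"
  have K: "nat \<bar>companion q a b\<bar> < K" if "a < d" for a b
    using member_le_sum[of a "{..<d}" "\<lambda>a. nat \<bar>coeff q a\<bar>"] that by (auto simp: companion_def K_def)
  \<comment> \<open>The coefficient of \<open>m\<close> counts \<open>K\<close> directions,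
    \<open>d\<close> companion rows and \<open>(K + 1) * m\<close> possible line values.\<close>
  have "n \<le> max_mult n x + (d - 1) * (n div d + 1) + (K * d * (K + 1)) * m" if nm: "n div d < m * m" for n m
  proof -
    define A :: "'a mat" where
      "A = mat n n (\<lambda>(i, j). of_int (block_entry m (companion q (i mod d) (j mod d)) (i div d) (j div d)))"
    have A: "A \<in> carrier_mat n n" by (simp add: A_def)
    have "of_int (block_entry m c P Q) \<in> {0, 1 :: 'a}" for c P Q
      using block_entry_01[of m c P Q] by auto
    then have "is_L_matrix n {0, 1} A"
      by (auto simp: is_L_matrix_def A_def)
    then have le: "geom_mult A x \<le> max_mult n x" by (rule geom_mult_le_max_mult)
    define T where "T = mat n n (\<lambda>(i, j). shifted_companion q x (i mod d) (j mod d) * of_bool (i div d = j div d))"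
    define h where "h s k j = (case k of (a, t) \<Rightarrow> (of_int (line_term m (companion q a (j mod d)) s t (j div d)) :: 'a))" for s k j
    define \<phi> where "\<phi> s i = (i mod d, line m s (i div d))" for s i
    define R where "R = mat n n (\<lambda>(i, j). \<Sum>s<K. h s (\<phi> s i) j)"
    have RT: "R \<in> carrier_mat n n" "T \<in> carrier_mat n n" by (auto simp: R_def T_def)
    have "char_matrix A x = R + T"
    proof (rule eq_matI)
      fix i j assume "i < dim_row (R + T)" "j < dim_col (R + T)"
      then have ij: "i < n" "j < n" by (auto simp: R_def T_def)
      have "i mod d < d" using d by simp
      have eq: "(i = j) = (i mod d = j mod d \<and> i div d = j div d)" by (metis div_mult_mod_eq)
      have "char_matrix A x $$ (i, j) =
          of_int (block_entry m (companion q (i mod d) (j mod d)) (i div d) (j div d)) - x * of_bool (i = j)"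
        using ij by (simp add: char_matrix_def A_def)
      also have "\<dots> = (R + T) $$ (i, j)"
        unfolding block_entry_eq_sum[OF K[OF \<open>i mod d < d\<close>]]
        using ij by (auto simp: R_def T_def h_def \<phi>_def shifted_companion_def eq algebra_simps)
      finally show "char_matrix A x $$ (i, j) = (R + T) $$ (i, j)" .
    qed (auto simp: A_def R_def T_def char_matrix_def)
    moreover have "vec_space.rank n R \<le> K * card ({..<d} \<times> {..<(K + 1) * m})"
    proof (rule rank_le_sum_distinct_rows[OF RT(1), where \<phi> = \<phi> and h = h])
      fix s i assume si: "s < K" "i < n"
      have "i div d \<le> n div d" using si by (simp add: div_le_mono)
      then have *: "i div d < m * m" using nm by simp
      then have "m > 0" by (cases m) auto
      with * have "(i div d) mod m < m" "(i div d) div m < m"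
        by (simp_all add: less_mult_imp_div_less)
      then have "line m s (i div d) < m + s * m"
        unfolding line_def by (intro add_less_le_mono mult_le_mono2) auto
      also have "\<dots> \<le> (K + 1) * m" using si by (simp add: add_mult_distrib)
      finally show "\<phi> s i \<in> {..<d} \<times> {..<(K + 1) * m}"
        using d by (simp add: \<phi>_def)
    qed (auto simp: R_def)
    moreover have "vec_space.rank n T \<le> (d - 1) * (n div d + 1)"
      by (rule rank_inflated_shifted_companion_le[OF q d RT(2)]) (auto simp: T_def)
    moreover have "vec_space.rank n (R + T) \<le> vec_space.rank n R + vec_space.rank n T"
      by (rule vec_space.rank_subadditive[OF RT])
    moreover have "vec_space.rank n (char_matrix A x) + geom_mult A x = n"
      unfolding geom_mult_def using A by (intro rank_plus_kernel_dim) simp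
    ultimately show ?thesis
      using le by (simp add: card_cartesian_product algebra_simps)
  qed
  then show thesis by (rule that)
qed

section \<open>Upper bounds\<close>

text \<open>The geometric multiplicity is at most the order of \<open>x\<close> as a root of the
  characteristic polynomial, which is the image of an integer polynomial because a {0,1}-matrix
  lifts to the integers.\<close>

lemma max_mult_times_degree_le:
  fixes x :: "'a::field"
  assumes "algebraic_int x"
  shows "max_mult n x * algebraic_int_degree x \<le> n"
proof -
  obtain A :: "'a mat" where A: "is_L_matrix n {0, 1} A" and mult: "geom_mult A x = max_mult n x"
    by (rule max_mult_attained)
  define B :: "int mat" where "B = map_mat (\<lambda>a. if a = 0 then 0 else 1) A"
  have dim: "A \<in> carrier_mat n n" "B \<in> carrier_mat n n" using A by (auto simp: is_L_matrix_def B_def)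
  have "A $$ (i, j) \<in> {0, 1}" if "i < n" "j < n" for i j
    using A that by (cases "i = j") (auto simp: is_L_matrix_def)
  then have "map_mat of_int B = A"
    using dim(1) by (intro eq_matI) (fastforce simp: B_def)+
  then have char_poly: "char_poly A = ipoly (char_poly B)"
    using of_int_hom.char_poly_hom[OF dim(2)] by metis
  have deg: "degree (char_poly A) = n" "char_poly A \<noteq> 0"
    using degree_monic_char_poly[OF dim(1)] by auto
  have "max_mult n x \<le> Polynomial.order x (char_poly A)"
    using power_geom_mult_dvd_char_poly[OF dim(1), of x] deg(2) by (simp add: order_divides mult)
  then have "max_mult n x * algebraic_int_degree x
      \<le> Polynomial.order x (char_poly A) * algebraic_int_degree x" by simp
  also have "\<dots> \<le> n"
    using order_times_algebraic_int_degree_le[OF assms, of "char_poly B"] deg by (simp add: char_poly)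
  finally show ?thesis .
qed

section \<open>Entrywise operations and the quadratic bound\<close>

lemma rank_smult_le:
  fixes A :: "'a::field mat"
  assumes A: "A \<in> carrier_mat n nc"
  shows "vec_space.rank n (c \<cdot>\<^sub>m A) \<le> vec_space.rank n A"
proof -
  obtain K u v where K: "finite (K :: nat set)" "card K = vec_space.rank n A"
    and uv: "\<forall>i<n. \<forall>j<nc. A $$ (i, j) = (\<Sum>k\<in>K. u i k * v k j)"
    by (rule rank_factorization[OF A])
  show ?thesis
    unfolding K(2)[symmetric] using A
    by (intro rank_le_sum_products_card[OF _ K(1), where u = "\<lambda>i k. c * u i k" and v = v])
      (auto simp: uv sum_distrib_left mult.assoc)
qed

text \<open>The product of two rank factorizations is a factorization indexed by pairs.\<close>

lemma rank_hadamard_product_le: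
  fixes A B :: "'a::field mat"
  assumes A: "A \<in> carrier_mat n nc" and B: "B \<in> carrier_mat n nc"
  shows "vec_space.rank n (mat n nc (\<lambda>ij. A $$ ij * B $$ ij)) \<le> vec_space.rank n A * vec_space.rank n B"
proof -
  obtain K u v where K: "finite (K :: nat set)" "card K = vec_space.rank n A"
    and uv: "\<forall>i<n. \<forall>j<nc. A $$ (i, j) = (\<Sum>k\<in>K. u i k * v k j)"
    by (rule rank_factorization[OF A])
  obtain L w z where L: "finite (L :: nat set)" "card L = vec_space.rank n B"
    and wz: "\<forall>i<n. \<forall>j<nc. B $$ (i, j) = (\<Sum>k\<in>L. w i k * z k j)"
    by (rule rank_factorization[OF B])
  have "vec_space.rank n (mat n nc (\<lambda>ij. A $$ ij * B $$ ij)) \<le> card (K \<times> L)"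
    using K L
    by (intro rank_le_sum_products_card[where u = "\<lambda>i (k, l). u i k * w i l" and v = "\<lambda>(k, l) j. v k j * z l j"])
      (auto simp: uv wz sum_product sum.cartesian_product case_prod_beta mult_ac)
  then show ?thesis using K L by (simp add: card_cartesian_product)
qed

lemma rank_all_equal_le:
  "vec_space.rank n (mat n nc (\<lambda>ij. c :: 'a::field)) \<le> 1"
  by (rule vec_space.rank_le_1_product_entries[where nc = nc and f = "\<lambda>_. c" and g = "\<lambda>_. 1"]) auto

lemma size_le_rank_square:
  fixes M :: "'a::field mat"
  assumes M: "is_L_matrix n {1, \<alpha>} M" and "\<alpha> \<noteq> 0"
  defines "r \<equiv> vec_space.rank n M"
  shows "n \<le> r * r + r + 1"
proof -
  define H where "H = mat n n (\<lambda>ij. M $$ ij * M $$ ij)"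
  define J where "J = mat n n (\<lambda>ij. \<alpha>)"
  have dim: "M \<in> carrier_mat n n" "- (1 + \<alpha>) \<cdot>\<^sub>m M \<in> carrier_mat n n" "H \<in> carrier_mat n n" "J \<in> carrier_mat n n"
    using M by (auto simp: is_L_matrix_def H_def J_def)
  \<comment> \<open>Entrywise (t - 1)(t - \<alpha>) = t^2 - (1 + \<alpha>) t + \<alpha>, which takes
    the value \<alpha> at the diagonal entries 0.\<close>
  have "\<alpha> \<cdot>\<^sub>m 1\<^sub>m n = H + (- (1 + \<alpha>) \<cdot>\<^sub>m M + J)"
  proof (rule eq_matI)
    fix i j assume "i < dim_row (H + (- (1 + \<alpha>) \<cdot>\<^sub>m M + J))" "j < dim_col (H + (- (1 + \<alpha>) \<cdot>\<^sub>m M + J))"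
    then have ij: "i < n" "j < n" using dim by auto
    then have "if i = j then M $$ (i, j) = 0 else M $$ (i, j) = 1 \<or> M $$ (i, j) = \<alpha>"
      using M by (auto simp: is_L_matrix_def)
    then show "(\<alpha> \<cdot>\<^sub>m 1\<^sub>m n) $$ (i, j) = (H + (- (1 + \<alpha>) \<cdot>\<^sub>m M + J)) $$ (i, j)"
      using ij dim by (auto simp: H_def J_def algebra_simps split: if_splits)
  qed (use dim in auto)
  then have "n = vec_space.rank n (H + (- (1 + \<alpha>) \<cdot>\<^sub>m M + J))"
    using rank_scalar_identity[OF \<open>\<alpha> \<noteq> 0\<close>, of n] by simp
  also have "\<dots> \<le> vec_space.rank n H + vec_space.rank n (- (1 + \<alpha>) \<cdot>\<^sub>m M + J)"
    using dim by (intro vec_space.rank_subadditive) auto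
  also have "vec_space.rank n (- (1 + \<alpha>) \<cdot>\<^sub>m M + J) \<le> vec_space.rank n (- (1 + \<alpha>) \<cdot>\<^sub>m M) + vec_space.rank n J"
    using dim by (intro vec_space.rank_subadditive) auto
  also have "vec_space.rank n (- (1 + \<alpha>) \<cdot>\<^sub>m M) \<le> r"
    unfolding r_def by (rule rank_smult_le[OF dim(1)])
  also have "vec_space.rank n J \<le> 1"
    unfolding J_def by (rule rank_all_equal_le)
  also have "vec_space.rank n H \<le> r * r"
    unfolding H_def r_def by (rule rank_hadamard_product_le[OF dim(1,1)])
  finally show ?thesis by simp
qed

text \<open>Makes the \<open>Max\<close> in \<open>max_size\<close> a true maximum.\<close>

lemma sizes_of_rank_le_bounded:
  fixes \<alpha> :: "'a::field"
  assumes "\<alpha> \<noteq> 0"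
  shows "{n. \<exists>A. is_L_matrix n {1, \<alpha>} A \<and> vec_space.rank n A \<le> r} \<subseteq> {..r * r + r + 1}"
proof
  fix n assume "n \<in> {n. \<exists>A. is_L_matrix n {1, \<alpha>} A \<and> vec_space.rank n A \<le> r}"
  then obtain A where A: "is_L_matrix n {1, \<alpha>} A" "vec_space.rank n A \<le> r" by blast
  have "n \<le> vec_space.rank n A * vec_space.rank n A + vec_space.rank n A + 1"
    by (rule size_le_rank_square[OF A(1) assms])
  also have "\<dots> \<le> r * r + r + 1" using A(2) by (intro add_mono mult_mono) auto
  finally show "n \<in> {..r * r + r + 1}" by simp
qed

lemma size_le_max_size:
  assumes "\<alpha> \<noteq> 0" "is_L_matrix n {1, \<alpha>} A" "vec_space.rank n A \<le> r"
  shows "n \<le> max_size r {1, \<alpha>}"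
  unfolding max_size_def using assms finite_subset[OF sizes_of_rank_le_bounded]
  by (intro Max_ge) blast+

lemma max_size_attained:
  fixes \<alpha> :: "'a::field"
  assumes "\<alpha> \<noteq> 0"
  obtains A where "is_L_matrix (max_size r {1, \<alpha>}) {1, \<alpha>} A"
    "vec_space.rank (max_size r {1, \<alpha>}) A \<le> r"
proof -
  let ?S = "{n. \<exists>A. is_L_matrix n {1, \<alpha>} A \<and> vec_space.rank n A \<le> r}"
  have "vec_space.rank 0 (0\<^sub>m 0 0 :: 'a mat) = 0" by (rule vec_space.rank_0I)
  then have "0 \<in> ?S" by (auto simp: is_L_matrix_def intro!: exI[of _ "0\<^sub>m 0 0"])
  then have "max_size r {1, \<alpha>} \<in> ?S"
    unfolding max_size_def using finite_subset[OF sizes_of_rank_le_bounded[OF assms]]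
    by (intro Max_in) blast+
  then show thesis using that by blast
qed

lemma max_size_le:
  "\<alpha> \<noteq> 0 \<Longrightarrow> max_size r {1, \<alpha>} \<le> r * r + r + 1"
  by (rule max_size_attained[of \<alpha> r]) (use sizes_of_rank_le_bounded[of \<alpha> r] in blast)+

section \<open>Passing between rank and multiplicity\<close>

text \<open>An extremal \<open>A\<close> gives M = J + (\<alpha> - 1)(A - x I), whose rank exceeds
  that of A - x I by at most 1. The hypothesis on \<open>n\<close> avoids truncated
  subtraction.\<close>

lemma max_size_ge:
  fixes \<alpha> :: "'a::field"
  assumes \<alpha>: "\<alpha> \<noteq> 0" "\<alpha> \<noteq> 1" and n: "n + 1 \<le> max_mult n (1 / (\<alpha> - 1)) + r"
  shows "n \<le> max_size r {1, \<alpha>}"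
proof -
  let ?x = "1 / (\<alpha> - 1)"
  obtain A where A: "is_L_matrix n {0, 1} A" and mult: "geom_mult A ?x = max_mult n ?x"
    by (rule max_mult_attained)
  then have dim: "A \<in> carrier_mat n n" by (simp add: is_L_matrix_def)
  define C where "C = char_matrix A ?x"
  have C: "C \<in> carrier_mat n n" using dim by (simp add: C_def)
  define J where "J = mat n n (\<lambda>ij. 1 :: 'a)"
  define M where "M = J + (\<alpha> - 1) \<cdot>\<^sub>m C"
  have "M $$ (i, j) = (if i = j then 0 else 1 + (\<alpha> - 1) * A $$ (i, j))" if "i < n" "j < n" for i j
    using that A dim \<alpha> by (auto simp: is_L_matrix_def M_def J_def C_def char_matrix_def)
  moreover have "A $$ (i, j) = 0 \<or> A $$ (i, j) = 1" if "i < n" "j < n" "i \<noteq> j" for i j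
    using that A by (auto simp: is_L_matrix_def)
  ultimately have "is_L_matrix n {1, \<alpha>} M"
    using C by (fastforce simp: is_L_matrix_def M_def J_def)
  moreover have "vec_space.rank n M \<le> r"
  proof -
    have "vec_space.rank n M \<le> vec_space.rank n J + vec_space.rank n ((\<alpha> - 1) \<cdot>\<^sub>m C)"
      unfolding M_def using C by (intro vec_space.rank_subadditive) (auto simp: J_def)
    also have "\<dots> \<le> 1 + vec_space.rank n C"
      unfolding J_def by (intro add_mono rank_all_equal_le rank_smult_le[OF C])
    finally show ?thesis
      using rank_plus_kernel_dim[OF C] mult n by (simp add: geom_mult_def C_def)
  qed
  ultimately show ?thesis by (rule size_le_max_size[OF \<alpha>(1)])
qed

lemma max_size_le_max_mult:
  fixes \<alpha> :: "'a::field" and r :: nat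
  assumes \<alpha>: "\<alpha> \<noteq> 0" "\<alpha> \<noteq> 1"
  defines "n \<equiv> max_size r {1, \<alpha>}"
  shows "n \<le> max_mult n (1 / (\<alpha> - 1)) + r + 1"
proof -
  let ?x = "1 / (\<alpha> - 1)"
  obtain M where M: "is_L_matrix n {1, \<alpha>} M" and rank: "vec_space.rank n M \<le> r"
    unfolding n_def by (rule max_size_attained[OF \<alpha>(1)])
  then have dim: "M \<in> carrier_mat n n" by (simp add: is_L_matrix_def)
  define A where "A = mat n n (\<lambda>(i, j). if i \<noteq> j \<and> M $$ (i, j) = \<alpha> then 1 else 0 :: 'a)"
  have A: "is_L_matrix n {0, 1} A" by (auto simp: A_def is_L_matrix_def)
  \<comment> \<open>Minus the all-ones matrix, so that \<open>M + J\<close> is (\<alpha> - 1)(A - x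
    I).\<close>
  define J where "J = mat n n (\<lambda>ij. - 1 :: 'a)"
  have MJ: "M + J \<in> carrier_mat n n" using dim by (simp add: J_def)
  have "char_matrix A ?x = ?x \<cdot>\<^sub>m (M + J)"
  proof (rule eq_matI)
    fix i j assume "i < dim_row (?x \<cdot>\<^sub>m (M + J))" "j < dim_col (?x \<cdot>\<^sub>m (M + J))"
    then have ij: "i < n" "j < n" using dim by (auto simp: J_def)
    then have "if i = j then M $$ (i, j) = 0 else M $$ (i, j) = 1 \<or> M $$ (i, j) = \<alpha>"
      using M by (auto simp: is_L_matrix_def)
    then show "char_matrix A ?x $$ (i, j) = (?x \<cdot>\<^sub>m (M + J)) $$ (i, j)"
      using ij dim \<alpha> by (auto simp: char_matrix_def A_def J_def split: if_splits)
  qed (use dim in \<open>auto simp: char_matrix_def A_def J_def\<close>)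
  then have "vec_space.rank n (char_matrix A ?x) \<le> vec_space.rank n (M + J)"
    using rank_smult_le[OF MJ] by simp
  also have "\<dots> \<le> vec_space.rank n M + vec_space.rank n J"
    using dim by (intro vec_space.rank_subadditive) (auto simp: J_def)
  also have "\<dots> \<le> r + 1"
    unfolding J_def by (intro add_mono rank rank_all_equal_le)
  finally have "vec_space.rank n (char_matrix A ?x) \<le> r + 1" .
  moreover have "vec_space.rank n (char_matrix A ?x) + geom_mult A ?x = n"
    unfolding geom_mult_def by (intro rank_plus_kernel_dim) (simp add: A_def)
  ultimately show ?thesis
    using geom_mult_le_max_mult[OF A, of ?x] by linarith
qed

section \<open>Asymptotics\<close>

lemma max_mult_lower_bound:
  fixes x :: "'a::field"
  assumes x: "algebraic_int x" and d: "algebraic_int_degree x = d" "d > 0"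
  obtains C :: real where "C \<ge> 1" "\<And>n. real n / real d - C * sqrt (real n) \<le> real (max_mult n x)"
proof -
  obtain q where q: "lead_coeff q = 1" "degree q = algebraic_int_degree x" "poly (ipoly q) x = 0"
    by (rule algebraic_int_degree_attained[OF x])
  obtain D where D: "\<And>n m. n div d < m * m \<Longrightarrow> n \<le> max_mult n x + (d - 1) * (n div d + 1) + D * m"
    using max_mult_lower_bound_grid[OF q(1,3), of d] q(2) d by metis
  have bound: "real n / real d - (real d + 2 * real D) * sqrt (real n) \<le> real (max_mult n x)" for n
  proof (cases "n = 0")
    case False
    \<comment> \<open>The least grid side with n < m^2; for n \<ge> 1 it is still at most 2 sqrt
      n.\<close>
    define m where "m = nat \<lfloor>sqrt (real n)\<rfloor> + 1"
    have sqrt1: "1 \<le> sqrt (real n)" using False by simp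
    have m: "real m \<le> 2 * sqrt (real n)" "sqrt (real n) \<le> real m"
      using sqrt1 unfolding m_def by linarith+
    have "sqrt (real n) < real m" unfolding m_def by linarith
    then have "real n < (real m)\<^sup>2" using real_le_rsqrt[of "real m" "real n"] by linarith
    then have "real n < real m * real m" by (simp add: power2_eq_square)
    then have "n < m * m" by (simp flip: of_nat_mult)
    then have "n div d < m * m" using div_le_dividend[of n d] by linarith
    then have "real n \<le> real (max_mult n x + (d - 1) * (n div d + 1) + D * m)"
      using D by (simp only: of_nat_le_iff)
    also have "\<dots> = real (max_mult n x) + (real d - 1) * (real (n div d) + 1) + real D * real m"
    proof -
      have "real (d - 1) = real d - 1" using d(2) by (simp add: of_nat_diff)
      then show ?thesis by (simp only: of_nat_add of_nat_mult of_nat_1)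
    qed
    also have "\<dots> \<le> real (max_mult n x) + (real d - 1) * (real n / real d + 1) + real D * (2 * sqrt (real n))"
      using m(1) d(2) of_nat_div_le_of_nat[of n d] by (intro add_mono mult_left_mono) auto
    also have "(real d - 1) * (real n / real d + 1) = real n - real n / real d + (real d - 1)"
      using d(2) by (simp add: field_simps)
    also have "real d - 1 \<le> real d * sqrt (real n)"
      using sqrt1 mult_left_mono[OF sqrt1, of "real d"] by simp
    finally show ?thesis by (simp add: algebra_simps)
  qed simp
  then show thesis using d(2) by (intro that[of "real d + 2 * real D"]) auto
qed

lemma max_size_ge_real:
  fixes \<alpha> :: "'a::field"
  assumes "\<alpha> \<noteq> 0" "\<alpha> \<noteq> 1" "real n - real (max_mult n (1 / (\<alpha> - 1))) + 1 \<le> real r"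
  shows "n \<le> max_size r {1, \<alpha>}"
  by (rule max_size_ge) (use assms in linarith)+

lemma bigo_sqrt_affine: "(\<lambda>n::nat. a * sqrt (real n) + b) \<in> O(\<lambda>n. sqrt (real n))"
proof (rule bigoI)
  show "\<forall>\<^sub>F n in at_top. norm (a * sqrt (real n) + b) \<le> (\<bar>a\<bar> + \<bar>b\<bar>) * norm (sqrt (real n))"
    using eventually_ge_at_top[of 1]
  proof eventually_elim
    case (elim n)
    then have "1 \<le> sqrt (real n)" by simp
    then have "\<bar>b\<bar> * 1 \<le> \<bar>b\<bar> * sqrt (real n)" by (intro mult_left_mono) auto
    moreover have "\<bar>a * sqrt (real n) + b\<bar> \<le> \<bar>a\<bar> * sqrt (real n) + \<bar>b\<bar>"
      by (rule order_trans[OF abs_triangle_ineq]) (simp add: abs_mult)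
    ultimately show ?case by (simp add: algebra_simps)
  qed
qed

section \<open>Degree 1\<close>

text \<open>The upper estimate is the grid construction. The lower one comes from the quadratic
  bound: a deficiency k = n - \<open>max_mult n x\<close> yields a {1,\<alpha>}-matrix of size
  \<open>n\<close> and rank at most k + 1.\<close>

lemma degree_1_max_mult:
  fixes \<alpha> :: "'a::field"
  defines "x \<equiv> 1 / (\<alpha> - 1)"
  assumes \<alpha>: "\<alpha> \<noteq> 0" "\<alpha> \<noteq> 1" and x: "algebraic_int x" "algebraic_int_degree x = 1"
  shows "(\<lambda>n. real n - real (max_mult n x)) \<in> \<Theta>(\<lambda>n. sqrt (real n))"
proof (rule bigthetaI)
  obtain C where C: "C \<ge> 1" "\<And>n. real n / real 1 - C * sqrt (real n) \<le> real (max_mult n x)"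
    by (rule max_mult_lower_bound[OF x]) auto
  have nonneg: "real (max_mult n x) \<le> real n" for n using max_mult_le_n by simp
  show "(\<lambda>n. real n - real (max_mult n x)) \<in> O(\<lambda>n. sqrt (real n))"
  proof (rule bigoI, rule always_eventually, rule allI)
    show "norm (real n - real (max_mult n x)) \<le> C * norm (sqrt (real n))" for n
      using C(2)[of n] nonneg[of n] by simp
  qed
  show "(\<lambda>n. real n - real (max_mult n x)) \<in> \<Omega>(\<lambda>n. sqrt (real n))"
  proof (rule landau_omega.bigI[of "1 / 3"])
    show "\<forall>\<^sub>F n in at_top. 1 / 3 * norm (sqrt (real n)) \<le> norm (real n - real (max_mult n x))"
      \<comment> \<open>For k = 0 the bound n \<le> k^2 + 3k + 3 gives n \<le> 3; so n \<ge> 4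
        forces k \<ge> 1, and then n \<le> 7k^2 \<le> (3k)^2.\<close>
      using eventually_ge_at_top[of 4]
    proof eventually_elim
      case (elim n)
      define k where "k = n - max_mult n x"
      have "n \<le> max_size (k + 1) {1, \<alpha>}"
        by (rule max_size_ge[OF \<alpha>]) (use max_mult_le_n[of n x] in \<open>simp add: k_def x_def\<close>)
      also have "\<dots> \<le> (k + 1) * (k + 1) + (k + 1) + 1" by (rule max_size_le[OF \<alpha>(1)])
      finally have n: "n \<le> k * k + 3 * k + 3" by (simp add: algebra_simps)
      have "k \<noteq> 0" using n elim by (cases k) auto
      then have "k * 1 \<le> k * k" "1 * 1 \<le> k * k" by (intro mult_le_mono; simp)+
      then have "n \<le> (3 * k) * (3 * k)" using n by linarith
      then have "real n \<le> (3 * real k)\<^sup>2"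
        by (metis of_nat_le_iff of_nat_mult of_nat_numeral power2_eq_square)
      then have "sqrt (real n) \<le> 3 * real k" by (simp add: real_le_lsqrt)
      moreover have "real k = real n - real (max_mult n x)"
        using max_mult_le_n[of n x] by (simp add: k_def of_nat_diff)
      ultimately show ?case by simp
    qed
  qed simp
qed

lemma degree_1_max_size:
  fixes \<alpha> :: "'a::field"
  defines "x \<equiv> 1 / (\<alpha> - 1)"
  assumes \<alpha>: "\<alpha> \<noteq> 0" "\<alpha> \<noteq> 1" and x: "algebraic_int x" "algebraic_int_degree x = 1"
  shows "(\<lambda>r. real (max_size r {1, \<alpha>})) \<in> \<Theta>(\<lambda>r. (real r)\<^sup>2)"
proof (rule bigthetaI)
  show "(\<lambda>r. real (max_size r {1, \<alpha>})) \<in> O(\<lambda>r. (real r)\<^sup>2)"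
  proof (rule bigoI)
    show "\<forall>\<^sub>F r in at_top. norm (real (max_size r {1, \<alpha>})) \<le> 3 * norm ((real r)\<^sup>2)"
      using eventually_ge_at_top[of 1]
    proof eventually_elim
      case (elim r)
      then have "r * 1 \<le> r * r" "1 * 1 \<le> r * r" by (intro mult_le_mono; simp)+
      then have "max_size r {1, \<alpha>} \<le> 3 * (r * r)" using max_size_le[OF \<alpha>(1), of r] by linarith
      then have "real (max_size r {1, \<alpha>}) \<le> real (3 * (r * r))" by (simp only: of_nat_le_iff)
      then show ?case by (simp add: power2_eq_square)
    qed
  qed
  obtain C where C: "C \<ge> 1" "\<And>n. real n / real 1 - C * sqrt (real n) \<le> real (max_mult n x)"
    by (rule max_mult_lower_bound[OF x]) auto
  show "(\<lambda>r. real (max_size r {1, \<alpha>})) \<in> \<Omega>(\<lambda>r. (real r)\<^sup>2)"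
  proof (rule landau_omega.bigI[of "1 / (8 * C\<^sup>2)"])
    show "\<forall>\<^sub>F r in at_top. 1 / (8 * C\<^sup>2) * norm ((real r)\<^sup>2) \<le> norm (real (max_size r {1, \<alpha>}))"
      using eventually_ge_at_top[of "nat \<lceil>3 * C\<rceil>"]
    proof eventually_elim
      case (elim r)
      then have r: "3 * C \<le> real r" by linarith
      \<comment> \<open>For n the floor of y^2 the deficiency is at most C sqrt n \<le> r - 1,
        leaving 1 for the rank of the all-ones matrix.\<close>
      define y where "y = (real r - 1) / C"
      have "y \<ge> 0" using r C(1) by (simp add: y_def)
      define n where "n = nat \<lfloor>y\<^sup>2\<rfloor>"
      have n: "real n \<le> y\<^sup>2" "y\<^sup>2 - 1 \<le> real n" unfolding n_def using zero_le_power2[of y] by linarith+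
      have "sqrt (real n) \<le> y" by (rule real_le_lsqrt[OF \<open>y \<ge> 0\<close> n(1)])
      then have "C * sqrt (real n) \<le> real r - 1"
        using C(1) mult_left_mono[of "sqrt (real n)" y C] by (simp add: y_def)
      then have "n \<le> max_size r {1, \<alpha>}"
        using C(2)[of n] by (intro max_size_ge_real[OF \<alpha>]) (simp add: x_def)
      then have ge: "y\<^sup>2 - 1 \<le> real (max_size r {1, \<alpha>})" using n(2) by linarith
      \<comment> \<open>From \<open>3 * C \<le> real r\<close> follow z \<le> y and z \<ge> 3/2, so
        half of z^2 absorbs the loss of 1. The constant 8 C^2 is 2 (2C)^2.\<close>
      define z where "z = real r / (2 * C)"
      have "z \<le> y" using r C(1) by (simp add: z_def y_def field_simps)
      moreover have "3 / 2 \<le> z" using r C(1) by (simp add: z_def field_simps)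
      ultimately have "z\<^sup>2 \<le> y\<^sup>2" "(3 / 2)\<^sup>2 \<le> z\<^sup>2" by (intro power_mono; simp)+
      then have "z\<^sup>2 / 2 \<le> y\<^sup>2 - 1" by (simp add: power2_eq_square)
      moreover have "z\<^sup>2 / 2 = 1 / (8 * C\<^sup>2) * (real r)\<^sup>2" by (simp add: z_def power_divide power_mult_distrib)
      ultimately show ?case using ge by simp
    qed
  qed (use C(1) in simp)
qed

section \<open>Degree greater than 1\<close>

lemma max_size_lower_bound:
  fixes \<alpha> :: "'a::field"
  defines "x \<equiv> 1 / (\<alpha> - 1)"
  assumes \<alpha>: "\<alpha> \<noteq> 0" "\<alpha> \<noteq> 1" and x: "algebraic_int x" "algebraic_int_degree x = d" and d: "d > 1"
  obtains f where "f \<in> O(\<lambda>r. sqrt (real r))"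
    "\<And>r. real d / (real d - 1) * real r - f r \<le> real (max_size r {1, \<alpha>})"
proof -
  obtain C where C: "C \<ge> 1" "\<And>n. real n / real d - C * sqrt (real n) \<le> real (max_mult n x)"
    using max_mult_lower_bound[OF x] d by auto
  define \<beta> where "\<beta> = real d / (real d - 1)"
  have \<beta>: "\<beta> > 0" "\<beta> \<le> 2" "1 / \<beta> = 1 - 1 / real d"
    using d by (auto simp: \<beta>_def field_simps)
  have bound: "\<beta> * real r - (2 * \<beta> * C * sqrt (real r) + (\<beta> + 1)) \<le> real (max_size r {1, \<alpha>})" for r
  proof -
    \<comment> \<open>What is left of the rank \<open>r\<close> after paying 1 for the all-ones
      matrix and 2 C sqrt r for the error C sqrt n, where n \<le> 4r. The size n is the floor of
      \<beta> y, since \<beta> is the inverse of 1 - 1/d.\<close>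
    define y where "y = real r - 2 * C * sqrt (real r) - 1"
    have "\<beta> * y - 1 \<le> real (max_size r {1, \<alpha>})"
    proof (cases "y \<ge> 0")
      case True
      define n where "n = nat \<lfloor>\<beta> * y\<rfloor>"
      have "\<beta> * y \<ge> 0" using True \<beta>(1) by simp
      then have n: "real n \<le> \<beta> * y" "\<beta> * y - 1 \<le> real n" unfolding n_def by linarith+
      have "0 \<le> C * sqrt (real r)" using C(1) by simp
      then have "y \<le> real r" by (simp add: y_def)
      then have "\<beta> * y \<le> 2 * real r" using \<beta> True by (intro mult_mono) auto
      then have "real n \<le> (2 * sqrt (real r))\<^sup>2" using n(1) by (simp add: power_mult_distrib)
      then have "sqrt (real n) \<le> 2 * sqrt (real r)" by (simp add: real_le_lsqrt)
      then have "C * sqrt (real n) \<le> C * (2 * sqrt (real r))" using C(1) by (intro mult_left_mono) auto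
      moreover have "real n - real n / real d \<le> y"
      proof -
        have "real n - real n / real d = real n * (1 / \<beta>)" by (simp add: \<beta>(3) right_diff_distrib)
        also have "\<dots> \<le> \<beta> * y * (1 / \<beta>)" using n(1) \<beta>(1) by (intro mult_right_mono) auto
        also have "\<dots> = y" using \<beta>(1) by simp
        finally show ?thesis .
      qed
      ultimately have "n \<le> max_size r {1, \<alpha>}"
        using C(2)[of n] by (intro max_size_ge_real[OF \<alpha>]) (simp add: x_def y_def)
      then show ?thesis using n(2) by linarith
    next
      \<comment> \<open>For small \<open>r\<close> the budget \<open>y\<close> may be negative, and
        then so is the claimed bound.\<close>
      case False
      then have "\<beta> * y \<le> 0" using \<beta>(1) by (simp add: mult_le_0_iff)
      then show ?thesis by linarith
    qed
    then show ?thesis by (simp add: y_def algebra_simps)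
  qed
  show thesis
    by (rule that[OF bigo_sqrt_affine, of "2 * \<beta> * C" "\<beta> + 1"]) (use bound in \<open>simp add: \<beta>_def\<close>)
qed

theorem theorem4:
  fixes \<alpha> lam :: "'a::field"
  assumes "\<alpha> \<noteq> 0" and "\<alpha> \<noteq> 1"
    and "lam = 1 / (\<alpha> - 1)"
    and "algebraic_int lam"
  shows "(algebraic_int_degree lam = 1 \<longrightarrow>
            (\<lambda>n. real n - real (max_mult n lam)) \<in> \<Theta>(\<lambda>n. sqrt (real n)) \<and>
            (\<lambda>r. real (max_size r {1, \<alpha>})) \<in> \<Theta>(\<lambda>r. (real r)\<^sup>2)) \<and>
         (\<forall>d. algebraic_int_degree lam = d \<and> d > 1 \<longrightarrow>
            (\<exists>f \<in> O(\<lambda>r. sqrt (real r)). \<forall>r.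
               real d / (real d - 1) * real r - f r \<le> real (max_size r {1, \<alpha>})) \<and>
            (\<forall>r. real (max_size r {1, \<alpha>}) \<le> real d / (real d - 1) * (real r + 1)) \<and>
            (\<exists>g \<in> O(\<lambda>n. sqrt (real n)). \<forall>n.
               real n / real d - g n \<le> real (max_mult n lam)) \<and>
            (\<forall>n. real (max_mult n lam) \<le> real n / real d))"
proof (intro conjI impI allI)
  assume "algebraic_int_degree lam = 1"
  then show "(\<lambda>n. real n - real (max_mult n lam)) \<in> \<Theta>(\<lambda>n. sqrt (real n))"
    and "(\<lambda>r. real (max_size r {1, \<alpha>})) \<in> \<Theta>(\<lambda>r. (real r)\<^sup>2)"
    using degree_1_max_mult[of \<alpha>] degree_1_max_size[of \<alpha>] assms by simp_all
next
  fix d assume d: "algebraic_int_degree lam = d \<and> d > 1"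
  have mult: "real (max_mult n lam) \<le> real n / real d" for n
  proof -
    have "real (max_mult n lam * d) \<le> real n"
      using max_mult_times_degree_le[OF assms(4), of n] d by (simp only: of_nat_le_iff)
    then show ?thesis using d by (simp add: pos_le_divide_eq)
  qed
  then show "real (max_mult n lam) \<le> real n / real d" for n .
  obtain f where "f \<in> O(\<lambda>r. sqrt (real r))"
    "\<And>r. real d / (real d - 1) * real r - f r \<le> real (max_size r {1, \<alpha>})"
    using max_size_lower_bound[of \<alpha> d] assms d by blast
  then show "\<exists>f \<in> O(\<lambda>r. sqrt (real r)). \<forall>r.
      real d / (real d - 1) * real r - f r \<le> real (max_size r {1, \<alpha>})" by blast
  obtain C where "\<And>n. real n / real d - C * sqrt (real n) \<le> real (max_mult n lam)"
    using max_mult_lower_bound[OF assms(4), of d] d by auto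
  then show "\<exists>g \<in> O(\<lambda>n. sqrt (real n)). \<forall>n. real n / real d - g n \<le> real (max_mult n lam)"
    using bigo_sqrt_affine[of C 0] by (intro bexI[of _ "\<lambda>n. C * sqrt (real n)"]) auto
  fix r
  define n where "n = max_size r {1, \<alpha>}"
  have "real n \<le> real (max_mult n lam + r + 1)"
    using max_size_le_max_mult[OF assms(1,2), of r] assms(3) by (simp only: n_def of_nat_le_iff)
  \<comment> \<open>The bound on the multiplicity is applied at the extremal size \<open>n\<close>
    itself; solving n (1 - 1/d) \<le> r + 1 for n gives the factor d/(d - 1).\<close>
  also have "\<dots> \<le> real n / real d + (real r + 1)" using mult[of n] by simp
  finally show "real (max_size r {1, \<alpha>}) \<le> real d / (real d - 1) * (real r + 1)"
    using d by (simp add: n_def[symmetric] field_simps)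
qed

end
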